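(* Let $\mathcal{L}$ be a duality-invariant (with $\psi=0$) causal theory of electrodynamics, and let $\gamma\ge 0$. Then the theory $\mathcal{M}_\gamma(\mathcal{L})$ is causal too.
   Context: A theory of electrodynamics is a function $\mathcal{L}$ of two real invariants $(s,p)$; here it is expressed through the variables $u,v\ge 0$ given by $$2u=\sqrt{s^2+p^2}-s,\qquad 2v=\sqrt{s^2+p^2}+s,$$ so that $\mathcal{L}=\mathcal{L}(u,v)$ on some domain $D\subseteq[0,\infty)^2$. The map $\mathcal{M}_\gamma$ replaces $s$ by $\mathcal{L}^{\mathrm{MM}}_\gamma(s,p)=\cosh\gamma\,s+\sinh\gamma\sqrt{s^2+p^2}$, that is, $\mathcal{M}_\gamma(\mathcal{L})(s,p)=\mathcal{L}(\mathcal{L}^{\mathrm{MM}}_\gamma(s,p),p)$. In the variables $(u,v)$ this reads $$\mathcal{M}_\gamma(\mathcal{L})(u,v)=\mathcal{L}(e^{-\gamma}u,e^{\gamma}v),$$ with domain $\{(u,v)\in[0,\infty)^2:(e^{-\gamma}u,e^{\gamma}v)\in D\}$. Duality invariance (with $\psi=0$) is the equation $\frac{\partial\mathcal{L}}{\partial u}\frac{\partial\mathcal{L}}{\partial v}=-1$. Duality-invariant theories are taken in their implicit representation: there are an interval $I=[0,\tau_{\max})$ with $0<\tau_{\max}\le\infty$ and a $C^2$ function $\ell:I\to\mathbb{R}$ with $\dot\ell>0$ such that for every $(u,v)\in D$ there is $\tau\in I$ with $$\tau=v+\frac{u}{\dot\ell(\tau)^2},\qquad \mathcal{L}(u,v)=\ell(\tau)-\frac{2u}{\dot\ell(\tau)}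 .$$ In this case we say that $\mathcal{L}$ is represented by $\ell$ (dots denote derivatives with respect to $\tau$). Causality: the theory $\mathcal{L}$, with domain $D$, is causal if there are an interval $I=[0,\tau_{\max})$ with $0<\tau_{\max}\le\infty$ and a $C^2$ function $\ell:I\to\mathbb{R}$ satisfying $\dot\ell\ge 1$ and $\ddot\ell\ge 0$ on $I$ such that for every $(u,v)\in D$ there is $\tau\in I$ with $\tau=v+\frac{u}{\dot\ell(\tau)^2}$ and $\mathcal{L}(u,v)=\ell(\tau)-\frac{2u}{\dot\ell(\tau)}$, i.e. if $\mathcal{L}$ is represented by some $\ell$ satisfying $\dot\ell\ge 1$ and $\ddot\ell\ge 0$ on $I$. (This is the known characterization of causality for duality-invariant theories, used here as the definition.) *)

theory Defs
  imports Complex_Main "HOL-Library.Extended_Real"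
begin

text \<open>
  A theory is a pair of a domain \<open>D\<close>, contained in the closed quadrant, and a function \<open>L\<close> of
  \<open>(u, v)\<close>, of which only the values on \<open>D\<close> matter.
\<close>

definition quadrant :: "(real \<times> real) set" where
  "quadrant = {0..} \<times> {0..}"

definition inv_u :: "real \<Rightarrow> real \<Rightarrow> real" where
  "inv_u s p = (sqrt (s\<^sup>2 + p\<^sup>2) - s) / 2"

definition inv_v :: "real \<Rightarrow> real \<Rightarrow> real" where
  "inv_v s p = (sqrt (s\<^sup>2 + p\<^sup>2) + s) / 2"

definition ModMax :: "real \<Rightarrow> real \<Rightarrow> real \<Rightarrow> real" where
  "ModMax \<gamma> s p = cosh \<gamma> * s + sinh \<gamma> * sqrt (s\<^sup>2 + p\<^sup>2)"

text \<open>
  The replacement of \<open>s\<close> by \<open>ModMax \<gamma> s p\<close>, written in the variables \<open>(u, v)\<close>. That this is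
  indeed the replacement is shown in \<open>M_map_inv\<close> and \<open>M_dom_inv\<close> below; since every
  point of the quadrant comes from some \<open>(s, p)\<close> (\<open>quadrant_eq_inv\<close>), these two facts determine
  the definitions on the quadrant.
\<close>

definition M_dom :: "real \<Rightarrow> (real \<times> real) set \<Rightarrow> (real \<times> real) set" where
  "M_dom \<gamma> D = {(u, v) \<in> quadrant. (exp (- \<gamma>) * u, exp \<gamma> * v) \<in> D}"

definition M_map :: "real \<Rightarrow> (real \<Rightarrow> real \<Rightarrow> real) \<Rightarrow> real \<Rightarrow> real \<Rightarrow> real" where
  "M_map \<gamma> L u v = L (exp (- \<gamma>) * u) (exp \<gamma> * v)"

text \<open>The interval \<open>[0, \<tau>\<^sub>m\<^sub>a\<^sub>x)\<close>, where \<open>\<tau>\<^sub>m\<^sub>a\<^sub>x\<close> may be infinite.\<close>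

definition ivl :: "ereal \<Rightarrow> real set" where
  "ivl \<tau>max = {t. 0 \<le> t \<and> ereal t < \<tau>max}"

text \<open>
  \<open>l\<close> is twice continuously differentiable on \<open>I\<close> with derivatives \<open>l'\<close> and \<open>l''\<close>. Derivatives are
  taken within \<open>I\<close>, hence one-sided at \<open>0\<close>; on a nondegenerate interval they are unique.
\<close>

definition C2_on :: "real set \<Rightarrow> (real \<Rightarrow> real) \<Rightarrow> (real \<Rightarrow> real) \<Rightarrow> (real \<Rightarrow> real) \<Rightarrow> bool" where
  "C2_on I l l' l'' \<longleftrightarrow>
     (\<forall>t\<in>I. (l has_real_derivative l' t) (at t within I)) \<and>
     (\<forall>t\<in>I. (l' has_real_derivative l'' t) (at t within I)) \<and>
     continuous_on I l''"

definition represented_by ::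
  "(real \<times> real) set \<Rightarrow> (real \<Rightarrow> real \<Rightarrow> real) \<Rightarrow>
   ereal \<Rightarrow> (real \<Rightarrow> real) \<Rightarrow> (real \<Rightarrow> real) \<Rightarrow> (real \<Rightarrow> real) \<Rightarrow> bool" where
  "represented_by D L \<tau>max l l' l'' \<longleftrightarrow>
     0 < \<tau>max \<and> C2_on (ivl \<tau>max) l l' l'' \<and> (\<forall>\<tau>\<in>ivl \<tau>max. 0 < l' \<tau>) \<and>
     (\<forall>(u, v)\<in>D. \<exists>\<tau>\<in>ivl \<tau>max. \<tau> = v + u / (l' \<tau>)\<^sup>2 \<and> L u v = l \<tau> - 2 * u / l' \<tau>)"

text \<open>
  Duality invariance with \<open>\<psi> = 0\<close>, i.e. the equation \<open>(\<partial>L/\<partial>u) (\<partial>L/\<partial>v) = -1\<close>, is taken in the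
  form of its implicit general solution; the domain need not be open.
\<close>

definition duality_invariant :: "(real \<times> real) set \<Rightarrow> (real \<Rightarrow> real \<Rightarrow> real) \<Rightarrow> bool" where
  "duality_invariant D L \<longleftrightarrow> (\<exists>\<tau>max l l' l''. represented_by D L \<tau>max l l' l'')"

definition causal :: "(real \<times> real) set \<Rightarrow> (real \<Rightarrow> real \<Rightarrow> real) \<Rightarrow> bool" where
  "causal D L \<longleftrightarrow>
     (\<exists>\<tau>max l l' l''. represented_by D L \<tau>max l l' l'' \<and>
        (\<forall>\<tau>\<in>ivl \<tau>max. 1 \<le> l' \<tau> \<and> 0 \<le> l'' \<tau>))"

lemma abs_le_sqrt_sum: "\<bar>s\<bar> \<le> sqrt (s\<^sup>2 + p\<^sup>2)" for s p :: real
  by (rule real_le_rsqrt) simp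

lemma inv_in_quadrant: "(inv_u s p, inv_v s p) \<in> quadrant"
proof -
  have "s \<le> sqrt (s\<^sup>2 + p\<^sup>2)" "- s \<le> sqrt (s\<^sup>2 + p\<^sup>2)"
    using abs_le_sqrt_sum[of s p] by linarith+
  then show ?thesis by (simp add: quadrant_def inv_u_def inv_v_def)
qed

lemma quadrant_eq_inv: "quadrant = {(inv_u s p, inv_v s p) | s p. True}"
proof
  show "quadrant \<subseteq> {(inv_u s p, inv_v s p) | s p. True}"
  proof
    fix x assume "x \<in> quadrant"
    then obtain u v where x: "x = (u, v)" and u: "0 \<le> u" and v: "0 \<le> v"
      by (auto simp: quadrant_def)
    have "(v - u)\<^sup>2 + (2 * sqrt (u * v))\<^sup>2 = (u + v)\<^sup>2"
      using u v by (simp add: power_mult_distrib) (simp add: power2_eq_square algebra_simps)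
    then have "sqrt ((v - u)\<^sup>2 + (2 * sqrt (u * v))\<^sup>2) = u + v"
      using u v by simp
    then have "x = (inv_u (v - u) (2 * sqrt (u * v)), inv_v (v - u) (2 * sqrt (u * v)))"
      unfolding x inv_u_def inv_v_def by simp
    then show "x \<in> {(inv_u s p, inv_v s p) | s p. True}" by blast
  qed
qed (auto simp: inv_in_quadrant)

lemma sqrt_ModMax:
  "sqrt ((ModMax \<gamma> s p)\<^sup>2 + p\<^sup>2) = cosh \<gamma> * sqrt (s\<^sup>2 + p\<^sup>2) + sinh \<gamma> * s"
proof -
  define r where "r = sqrt (s\<^sup>2 + p\<^sup>2)"
  have r2: "p\<^sup>2 = r\<^sup>2 - s\<^sup>2" by (simp add: r_def)
  have "\<bar>sinh \<gamma>\<bar> \<le> cosh \<gamma>"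
    by (smt (verit) cosh_minus cosh_real_nonneg sinh_le_cosh_real sinh_minus)
  then have "\<bar>sinh \<gamma> * s\<bar> \<le> cosh \<gamma> * r"
    using abs_le_sqrt_sum[of s p] unfolding abs_mult r_def
    by (intro mult_mono) auto
  then have nn: "0 \<le> cosh \<gamma> * r + sinh \<gamma> * s" by linarith
  have "(cosh \<gamma> * s + sinh \<gamma> * r)\<^sup>2 + p\<^sup>2
      = (cosh \<gamma> * r + sinh \<gamma> * s)\<^sup>2 + ((cosh \<gamma>)\<^sup>2 - (sinh \<gamma>)\<^sup>2 - 1) * (s\<^sup>2 - r\<^sup>2)"
    unfolding r2 by (simp add: power2_eq_square algebra_simps)
  also have "\<dots> = (cosh \<gamma> * r + sinh \<gamma> * s)\<^sup>2"
    by (simp add: cosh_square_eq)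
  finally show ?thesis
    unfolding ModMax_def r_def[symmetric] using nn by simp
qed

lemma inv_ModMax:
  "inv_u (ModMax \<gamma> s p) p = exp (- \<gamma>) * inv_u s p"
  "inv_v (ModMax \<gamma> s p) p = exp \<gamma> * inv_v s p"
proof -
  have e: "exp \<gamma> = cosh \<gamma> + sinh \<gamma>" "exp (- \<gamma>) = cosh \<gamma> - sinh \<gamma>"
    by (simp_all add: cosh_plus_sinh cosh_minus_sinh)
  show "inv_u (ModMax \<gamma> s p) p = exp (- \<gamma>) * inv_u s p"
    "inv_v (ModMax \<gamma> s p) p = exp \<gamma> * inv_v s p"
    unfolding inv_u_def inv_v_def sqrt_ModMax e unfolding ModMax_def by (simp_all add: field_simps)
qed

lemma M_map_inv:
  "M_map \<gamma> L (inv_u s p) (inv_v s p) = L (inv_u (ModMax \<gamma> s p) p) (inv_v (ModMax \<gamma> s p) p)"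
  by (simp add: M_map_def inv_ModMax)

lemma M_dom_inv:
  "(inv_u s p, inv_v s p) \<in> M_dom \<gamma> D \<longleftrightarrow>
   (inv_u (ModMax \<gamma> s p) p, inv_v (ModMax \<gamma> s p) p) \<in> D"
  by (simp add: M_dom_def inv_ModMax inv_in_quadrant)

end

theory Submission
  imports Defs
begin

text \<open>
  If \<open>l\<close> represents \<open>L\<close>, then \<open>t \<mapsto> l (exp \<gamma> * t)\<close>, on the interval shrunk by \<open>exp \<gamma>\<close>, represents
  \<open>M_map \<gamma> L\<close>: the parameter \<open>\<tau>\<close> of \<open>L\<close> at \<open>(exp (- \<gamma>) * u, exp \<gamma> * v)\<close> becomes \<open>exp (- \<gamma>) * \<tau>\<close>.
  The first and second derivatives get multiplied by \<open>exp \<gamma>\<close> and \<open>(exp \<gamma>)\<^sup>2\<close>, and \<open>exp \<gamma> \<ge> 1\<close> for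
  \<open>\<gamma> \<ge> 0\<close>, so causality is preserved.
\<close>

text \<open>Dividing by a positive real fixes \<open>\<infinity>\<close>, so one formula covers
  finite and infinite \<open>\<tau>max\<close>. If \<open>\<tau>max\<close> is
  \<open>-\<infinity>\<close>, both intervals are empty.\<close>

lemma mem_ivl_divide_iff:
  assumes "0 < c"
  shows "t \<in> ivl (\<tau>max / ereal c) \<longleftrightarrow> c * t \<in> ivl \<tau>max"
proof (cases \<tau>max)
  case (real r)
  then show ?thesis
    using assms by (simp add: ivl_def zero_le_mult_iff pos_less_divide_eq mult.commute[of t])
qed (use assms in \<open>simp_all add: ivl_def zero_le_mult_iff\<close>)

text \<open>The chain rule for derivatives within sets asks for the derivative of \<open>f\<close>
  within the image of \<open>I\<close>, so the one within \<open>J\<close> is first restricted to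
  that image. This covers the one-sided derivative at 0.\<close>

lemma has_real_derivative_rescale:
  assumes "(f has_real_derivative d) (at (c * t) within J)" and "(*) c ` I \<subseteq> J"
  shows "((\<lambda>x. f (c * x)) has_real_derivative c * d) (at t within I)"
proof -
  have "(f has_real_derivative d) (at (c * t) within (*) c ` I)"
    using assms by (rule DERIV_subset)
  moreover have "((*) c has_real_derivative c) (at t within I)"
    by (auto intro!: derivative_eq_intros)
  ultimately show ?thesis
    using DERIV_image_chain[of f d "(*) c" t I c] by (simp add: o_def mult.commute)
qed

lemma C2_on_rescale:
  assumes "C2_on J l l' l''" and sub: "(*) c ` I \<subseteq> J"
  shows "C2_on I (\<lambda>t. l (c * t)) (\<lambda>t. c * l' (c * t)) (\<lambda>t. c\<^sup>2 * l'' (c * t))"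
  unfolding C2_on_def
proof (intro conjI ballI)
  fix t assume "t \<in> I"
  then have "c * t \<in> J" using sub by auto
  then have d: "(l has_real_derivative l' (c * t)) (at (c * t) within J)"
    "(l' has_real_derivative l'' (c * t)) (at (c * t) within J)"
    using assms(1) by (auto simp: C2_on_def)
  show "((\<lambda>t. l (c * t)) has_real_derivative c * l' (c * t)) (at t within I)"
    using d(1) sub by (rule has_real_derivative_rescale)
  show "((\<lambda>t. c * l' (c * t)) has_real_derivative c\<^sup>2 * l'' (c * t)) (at t within I)"
    using DERIV_cmult[OF has_real_derivative_rescale[OF d(2) sub], of c]
    by (simp add: power2_eq_square mult.assoc)
next
  have "continuous_on J l''" using assms(1) by (simp add: C2_on_def)
  then have "continuous_on I (\<lambda>t. l'' (c * t))"
    by (rule continuous_on_compose2) (use sub in \<open>auto intro: continuous_intros\<close>)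
  then show "continuous_on I (\<lambda>t. c\<^sup>2 * l'' (c * t))"
    by (intro continuous_intros)
qed

lemma represented_by_M_map:
  assumes "represented_by D L \<tau>max l l' l''"
  shows "represented_by (M_dom \<gamma> D) (M_map \<gamma> L) (\<tau>max / ereal (exp \<gamma>))
    (\<lambda>t. l (exp \<gamma> * t)) (\<lambda>t. exp \<gamma> * l' (exp \<gamma> * t)) (\<lambda>t. (exp \<gamma>)\<^sup>2 * l'' (exp \<gamma> * t))"
proof -
  define c where "c = exp \<gamma>"
  have c: "0 < c" by (simp add: c_def)
  have ec: "exp (- \<gamma>) = 1 / c" by (simp add: c_def exp_minus inverse_eq_divide)
  note mem = mem_ivl_divide_iff[OF c, of _ \<tau>max]
  have max: "0 < \<tau>max" and C2: "C2_on (ivl \<tau>max) l l' l''"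
    and pos: "\<And>\<tau>. \<tau> \<in> ivl \<tau>max \<Longrightarrow> 0 < l' \<tau>"
    and L: "\<And>x. x \<in> D \<Longrightarrow> case x of (u, v) \<Rightarrow>
      \<exists>\<tau>\<in>ivl \<tau>max. \<tau> = v + u / (l' \<tau>)\<^sup>2 \<and> L u v = l \<tau> - 2 * u / l' \<tau>"
    using assms unfolding represented_by_def by blast+
  have rep: "\<exists>t\<in>ivl (\<tau>max / ereal c). t = v + u / (c * l' (c * t))\<^sup>2 \<and>
      M_map \<gamma> L u v = l (c * t) - 2 * u / (c * l' (c * t))"
    if "(u, v) \<in> M_dom \<gamma> D" for u v
  proof -
    have "(u / c, c * v) \<in> D"
      using that by (simp add: M_dom_def ec c_def)
    from L[OF this, unfolded prod.case] obtain \<tau>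
      where \<tau>: "\<tau> \<in> ivl \<tau>max" "\<tau> = c * v + u / c / (l' \<tau>)\<^sup>2"
        "L (u / c) (c * v) = l \<tau> - 2 * (u / c) / l' \<tau>"
      by blast
    have ct: "c * (\<tau> / c) = \<tau>" using c by simp
    show ?thesis
    proof (intro bexI conjI)
      show "\<tau> / c \<in> ivl (\<tau>max / ereal c)"
        unfolding mem ct by (rule \<tau>(1))
      have "\<tau> / c = (c * v + u / c / (l' \<tau>)\<^sup>2) / c"
        using \<tau>(2) by (rule arg_cong)
      \<comment> \<open>One factor \<open>1 / c\<close> comes from the argument \<open>u / c\<close>
        of \<open>L\<close>, the other from rescaling \<open>\<tau>\<close>. Together they form the
        square of the factor that the derivative gains.\<close>
      also have "\<dots> = v + u / (c * l' \<tau>)\<^sup>2"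
        using c pos[OF \<tau>(1)] by (simp add: add_divide_distrib power2_eq_square mult_ac)
      finally show "\<tau> / c = v + u / (c * l' (c * (\<tau> / c)))\<^sup>2"
        unfolding ct .
      \<comment> \<open>Here \<open>\<tau>\<close> enters only through \<open>l\<close> and
        \<open>l'\<close>, so the single \<open>1 / c\<close> from the argument \<open>u / c\<close>
        matches the first power of the new derivative.\<close>
      show "M_map \<gamma> L u v = l (c * (\<tau> / c)) - 2 * u / (c * l' (c * (\<tau> / c)))"
        unfolding ct M_map_def ec c_def[symmetric] using \<tau>(3) by simp
    qed
  qed
  have "0 < \<tau>max / ereal c"
    using max c by (cases \<tau>max) auto
  moreover have "C2_on (ivl (\<tau>max / ereal c)) (\<lambda>t. l (c * t)) (\<lambda>t. c * l' (c * t))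
      (\<lambda>t. c\<^sup>2 * l'' (c * t))"
    using C2 by (rule C2_on_rescale) (auto simp: mem)
  moreover have "0 < c * l' (c * t)" if "t \<in> ivl (\<tau>max / ereal c)" for t
    using pos that c by (simp add: mem)
  ultimately show ?thesis
    unfolding represented_by_def c_def[symmetric] using rep
    by (intro conjI ballI case_prodI2) blast+
qed

theorem theorem2:
  fixes D :: "(real \<times> real) set" and L :: "real \<Rightarrow> real \<Rightarrow> real" and \<gamma> :: real
  assumes "D \<subseteq> quadrant"
    and "duality_invariant D L"
    and "causal D L"
    and "0 \<le> \<gamma>"
  shows "causal (M_dom \<gamma> D) (M_map \<gamma> L)"
proof -
  from \<open>causal D L\<close> obtain \<tau>max l l' l'' where rep: "represented_by D L \<tau>max l l' l''"
    and l: "\<And>\<tau>. \<tau> \<in> ivl \<tau>max \<Longrightarrow> 1 \<le> l' \<tau> \<and> 0 \<le> l'' \<tau>"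
    unfolding causal_def by blast
  have "1 \<le> exp \<gamma> * l' (exp \<gamma> * t) \<and> 0 \<le> (exp \<gamma>)\<^sup>2 * l'' (exp \<gamma> * t)"
    if "t \<in> ivl (\<tau>max / ereal (exp \<gamma>))" for t
  proof -
    have "1 \<le> l' (exp \<gamma> * t)" "0 \<le> l'' (exp \<gamma> * t)"
      using l that by (simp_all add: mem_ivl_divide_iff)
    \<comment> \<open>The sign of \<gamma> matters here: a factor below 1 could push the first
      derivative below 1, whereas the second derivative is scaled by a square and stays
      nonnegative.\<close>
    moreover have "1 \<le> exp \<gamma>" using \<open>0 \<le> \<gamma>\<close> by simp
    ultimately show ?thesis
      using mult_mono[of 1 "exp \<gamma>" 1 "l' (exp \<gamma> * t)"] by simp
  qed
  then show ?thesis
    using represented_by_M_map[OF rep] unfolding causal_def by blast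
qed

end
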